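(* Let $W_m'(s)=Z_m(s)/P_m(s)$, where $Z_m,P_m$ are monic real polynomials with $\deg P_m=m\ge 1$, $\deg Z_m=m-1$ (relative degree one) and $Z_m$ Hurwitz (minimum phase). Let $(A_m,b_m,c_m^T)$ be the $m$-dimensional realization of $W_m'$ in observer canonical form, with $c_m^T=[0\ \cdots\ 0\ 1]$. For $\ell\in\mathbb R^m$ let $k_\ell Z_\ell(s)$ denote the numerator polynomial defined by $c_m^T(sI-A_m)^{-1}\ell=k_\ell Z_\ell(s)/P_m(s)$, and put $$W_e'(s)=\frac{Z_m(s)}{P_m(s)+k_\ell Z_\ell(s)} .$$ Then there exists $\ell\in\mathbb R^m$ such that $W_e'(s)$ is strictly positive real.
   Context: Observer canonical form: $A_m\in\mathbb R^{m\times m}$ is the companion matrix with $\det(sI-A_m)=P_m(s)$ for which $c_m^T=[0\ \cdots\ 0\ 1]$ and $c_m^T(sI-A_m)^{-1}\ell=(\ell_m s^{m-1}+\dots+\ell_2 s+\ell_1)/P_m(s)$ for every $\ell=(\ell_1,\dots,\ell_m)^T$; thus the polynomial $k_\ell Z_\ell(s)$ is the real polynomial of degree at most $m-1$ with coefficients given by $\ell$. The vector $b_m$ satisfies $c_m^T(sI-A_m)^{-1}b_m=W_m'(s)$. A polynomial is Hurwitz if all its roots have negative real part (a nonzero constant is Hurwitz). A real rational function $H(s)$, not identically zero, is positive real if it is analytic in $\mathrm{Re}\,s>0$ and $\mathrm{Re}\,H(s)\ge 0$ for $\mathrm{Re}\,s>0$; it is strictly positive real (SPR) if $H(s-\varepsilon)$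 is positive real for some $\varepsilon>0$. *)

theory Defs
  imports
    "HOL-Complex_Analysis.Complex_Analysis"
    "HOL-Computational_Algebra.Polynomial_Factorial"
    "HOL-Computational_Algebra.Field_as_Ring"
    "Jordan_Normal_Form.Char_Poly"
    "Jordan_Normal_Form.Gauss_Jordan_Elimination"
begin

no_notation inner (infix "\<bullet>" 70)

text \<open>Real rational functions are elements of the field \<^typ>\<open>real poly fract\<close>; a real number
  embeds as a constant.\<close>

definition rconst :: "real \<Rightarrow> real poly fract" where
  "rconst x = to_fract [:x:]"

text \<open>Evaluation uses the representation in lowest terms, so removable singularities are removed.
  At a genuine pole the value is \<open>0\<close> by the convention \<open>x / 0 = 0\<close>; since the function is unbounded
  near a pole, it is not analytic there.\<close>

definition rat_eval :: "real poly fract \<Rightarrow> complex \<Rightarrow> complex" where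
  "rat_eval H s = (case quot_of_fract H of (p, q) \<Rightarrow>
     poly (map_poly complex_of_real p) s / poly (map_poly complex_of_real q) s)"

definition hurwitz :: "real poly \<Rightarrow> bool" where
  "hurwitz p \<longleftrightarrow> (\<forall>s. poly (map_poly complex_of_real p) s = 0 \<longrightarrow> Re s < 0)"

definition positive_real :: "(complex \<Rightarrow> complex) \<Rightarrow> bool" where
  "positive_real f \<longleftrightarrow>
     (\<exists>H. H \<noteq> 0 \<and> f = rat_eval H) \<and>
     f analytic_on {s. Re s > 0} \<and>
     (\<forall>s. Re s > 0 \<longrightarrow> Re (f s) \<ge> 0)"

definition strictly_positive_real :: "(complex \<Rightarrow> complex) \<Rightarrow> bool" where
  "strictly_positive_real f \<longleftrightarrow> (\<exists>\<epsilon>>0. positive_real (\<lambda>s. f (s - complex_of_real \<epsilon>)))"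

text \<open>The transfer function \<open>c\<^sup>T (s I - A)\<inverse> b\<close>, computed over the field of real rational functions;
  there \<open>s I - A\<close> is always invertible.\<close>

definition resolvent :: "real mat \<Rightarrow> real poly fract mat" where
  "resolvent A = the (mat_inverse (map_mat to_fract (char_poly_matrix A)))"

definition transfer_function :: "real mat \<Rightarrow> real vec \<Rightarrow> real vec \<Rightarrow> real poly fract" where
  "transfer_function A b c = map_vec rconst c \<bullet> (resolvent A *\<^sub>v map_vec rconst b)"

text \<open>For \<open>P = s\<^sup>m + p\<^bsub>m-1\<^esub> s\<^bsup>m-1\<^esup> + \<dots> + p\<^sub>0\<close>: ones on the subdiagonal and last column
  \<open>(-p\<^sub>0, \<dots>, -p\<^bsub>m-1\<^esub>)\<close>.\<close>

definition observer_matrix :: "real poly \<Rightarrow> real mat" where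
  "observer_matrix P = mat (degree P) (degree P)
     (\<lambda>(i, j). if j = degree P - 1 then - coeff P i else if i = j + 1 then 1 else 0)"

lemma observer_matrix_carrier [simp]:
  "observer_matrix P \<in> carrier_mat (degree P) (degree P)"
  by (simp add: observer_matrix_def)

lemma monomial_row_observer:
  assumes "monic P" "degree P \<ge> 1" "j < degree P"
  shows "(\<Sum>i<degree P. monom 1 i * char_poly_matrix (observer_matrix P) $$ (i, j)) =
           (if j = degree P - 1 then P else 0)"
proof -
  let ?m = "degree P"
  have entry: "char_poly_matrix (observer_matrix P) $$ (i, j) =
      (if i = j then [:0, 1:] else 0) +
      (if j = ?m - 1 then [:coeff P i:] else if i = j + 1 then - 1 else 0)" if "i < ?m" for i
    using that assms(3)
    by (auto simp: char_poly_matrix_def observer_matrix_def one_pCons)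
  have P: "monom 1 ?m + (\<Sum>i<?m. monom (coeff P i) i) = P"
    using poly_as_sum_of_monoms[of P] assms(1)
    by (simp add: lessThan_Suc_atMost[symmetric] add.commute)
  have X: "pCons 0 (monom 1 (?m - Suc 0)) = (monom 1 ?m :: real poly)"
    using assms(2) by (cases ?m) (simp_all add: monom_Suc)
  have "(\<Sum>i<?m. monom 1 i * char_poly_matrix (observer_matrix P) $$ (i, j)) =
     (\<Sum>i<?m. if i = j then monom 1 (Suc j) else 0) +
     (\<Sum>i<?m. if j = ?m - 1 then monom (coeff P i) i
               else if i = j + 1 then - monom 1 (Suc j) else 0)"
    unfolding sum.distrib[symmetric]
    by (intro sum.cong refl) (auto simp: entry X monom_Suc smult_monom algebra_simps)
  also have "\<dots> = (if j = ?m - 1 then P else 0)"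
  proof (cases "j = ?m - 1")
    case True
    then have "Suc j = ?m" using assms(2) by simp
    then show ?thesis using True assms(3) by (simp add: P)
  next
    case False
    then have "Suc j < ?m" using assms(3) by simp
    then show ?thesis using False by simp
  qed
  finally show ?thesis .
qed

lemma char_poly_observer_matrix:
  assumes "monic P" "degree P \<ge> 1"
  shows "char_poly (observer_matrix P) = P"
proof -
  let ?m = "degree P"
  let ?M = "char_poly_matrix (observer_matrix P)"
  let ?r = "vec ?m (\<lambda>i. monom 1 i) :: real poly vec"
  let ?c = "vec ?m (\<lambda>j. if j = ?m - 1 then P else 0)"
  have M: "?M \<in> carrier_mat ?m ?m" by simp
  then have dims: "dim_row ?M = ?m" "dim_col ?M = ?m" by (metis carrier_matD)+
  note adj = adj_mat[OF M]
  have row: "?M\<^sup>T *\<^sub>v ?r = ?c"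
  proof (intro eq_vecI)
    fix j assume "j < dim_vec ?c"
    then have j: "j < ?m" by simp
    have "(?M\<^sup>T *\<^sub>v ?r) $ j = (\<Sum>i<?m. monom 1 i * ?M $$ (i, j))"
      using j dims by (simp add: scalar_prod_def lessThan_atLeast0 mult.commute)
    then show "(?M\<^sup>T *\<^sub>v ?r) $ j = ?c $ j"
      using monomial_row_observer[OF assms j] j by simp
  qed (use dims in auto)
  have "det ?M \<cdot>\<^sub>v ?r = (?M * adj_mat ?M)\<^sup>T *\<^sub>v ?r"
    by (subst adj(2)) (intro eq_vecI, auto)
  also have "\<dots> = (adj_mat ?M)\<^sup>T *\<^sub>v ?c"
    unfolding transpose_mult[OF M adj(1)] row[symmetric]
    by (rule assoc_mult_mat_vec) (use M adj(1) in auto)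
  finally have "(det ?M \<cdot>\<^sub>v ?r) $ 0 = ((adj_mat ?M)\<^sup>T *\<^sub>v ?c) $ 0" by simp
  moreover have "((adj_mat ?M)\<^sup>T *\<^sub>v ?c) $ 0 = (\<Sum>j<?m. col (adj_mat ?M) 0 $ j * ?c $ j)"
    using assms(2) adj(1) by (simp add: scalar_prod_def lessThan_atLeast0)
  moreover have "P dvd \<dots>" by (intro dvd_sum) auto
  ultimately have "P dvd char_poly (observer_matrix P)"
    using assms(2) by (simp add: char_poly_def)
  then obtain q where q: "char_poly (observer_matrix P) = P * q" by (auto elim: dvdE)
  have cp: "degree (P * q) = ?m" "monic (P * q)"
    using degree_monic_char_poly[OF observer_matrix_carrier, of P] q by auto
  have "P \<noteq> 0" "q \<noteq> 0" using cp assms by auto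
  then have "degree q = 0" using cp by (simp add: degree_mult_eq)
  moreover have "lead_coeff q = 1" using cp(2) assms(1) by (simp add: lead_coeff_mult)
  ultimately have "q = 1" by (metis monic_degree_0)
  then show ?thesis using q by simp
qed

lemma transfer_function_observer:
  assumes P: "monic P" "degree P = m" "m \<ge> 1" and l: "l \<in> carrier_vec m"
  shows "transfer_function (observer_matrix P) l (unit_vec m (m - 1)) =
           to_fract (\<Sum>i<m. monom (l $ i) i) / to_fract P"
proof -
  interpret F: comm_ring_hom "to_fract :: real poly \<Rightarrow> real poly fract"
    by unfold_locales simp_all
  let ?A = "observer_matrix P"
  define M where "M = map_mat to_fract (char_poly_matrix ?A)"
  define v where "v = map_vec rconst l"
  define r where "r = vec m (\<lambda>i. to_fract (monom (1 :: real) i))"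
  define e :: "real poly fract vec" where "e = unit_vec m (m - 1)"
  have A: "?A \<in> carrier_mat m m" using observer_matrix_carrier[of P] P(2) by simp
  have C: "char_poly_matrix ?A \<in> carrier_mat m m" using A by simp
  have M: "M \<in> carrier_mat m m" using C by (simp add: M_def)
  have v: "v \<in> carrier_vec m" and r: "r \<in> carrier_vec m" and e: "e \<in> carrier_vec m"
    using l by (auto simp: v_def r_def e_def)
  have "P \<noteq> 0" using P by auto
  have "det M = to_fract P"
    using char_poly_observer_matrix[of P] P by (simp add: M_def char_poly_def)
  then have "det M \<noteq> 0" using \<open>P \<noteq> 0\<close> by simp
  then have "mat_inverse M \<noteq> None"
    using mat_inverse(1)[OF M, where b = "()"] det_non_zero_imp_unit[OF M, where b = "()"] by blast
  then obtain B where B: "mat_inverse M = Some B" by blast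
  have MB: "M * B = 1\<^sub>m m" and Bc: "B \<in> carrier_mat m m" using mat_inverse(2)[OF M B] by auto
  have row: "M\<^sup>T *\<^sub>v r = to_fract P \<cdot>\<^sub>v e"
  proof (intro eq_vecI)
    fix j assume "j < dim_vec (to_fract P \<cdot>\<^sub>v e)"
    then have j: "j < m" using e by simp
    have "(M\<^sup>T *\<^sub>v r) $ j =
        (\<Sum>i<m. to_fract (monom 1 i) * to_fract (char_poly_matrix ?A $$ (i, j)))"
      using j M C by (simp add: M_def r_def scalar_prod_def lessThan_atLeast0 mult.commute)
    also have "\<dots> = to_fract (\<Sum>i<m. monom 1 i * char_poly_matrix ?A $$ (i, j))"
      by (simp add: F.hom_sum)
    also have "\<dots> = (to_fract P \<cdot>\<^sub>v e) $ j"
      using monomial_row_observer[of P j] P j by (simp add: e_def)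
    finally show "(M\<^sup>T *\<^sub>v r) $ j = (to_fract P \<cdot>\<^sub>v e) $ j" .
  qed (use M e in auto)
  have Bv: "B *\<^sub>v v \<in> carrier_vec m" using Bc v by simp
  have "to_fract P * (e \<bullet> (B *\<^sub>v v)) = (to_fract P \<cdot>\<^sub>v e) \<bullet> (B *\<^sub>v v)"
    using e Bv by simp
  also have "\<dots> = r \<bullet> (M *\<^sub>v (B *\<^sub>v v))"
    using transpose_vec_mult_scalar[OF M Bv r] by (simp add: row)
  also have "M *\<^sub>v (B *\<^sub>v v) = v"
    using MB v assoc_mult_mat_vec[OF M Bc v] by simp
  also have "r \<bullet> v = (\<Sum>i<m. to_fract (monom 1 i) * to_fract [:l $ i:])"
    using l by (simp add: r_def v_def scalar_prod_def lessThan_atLeast0 rconst_def)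
  also have "\<dots> = to_fract (\<Sum>i<m. monom (l $ i) i)"
    unfolding F.hom_sum F.hom_mult[symmetric] by (simp add: smult_monom)
  finally have "e \<bullet> (B *\<^sub>v v) = to_fract (\<Sum>i<m. monom (l $ i) i) / to_fract P"
    using \<open>P \<noteq> 0\<close> by (simp add: field_simps)
  moreover have "map_vec rconst (unit_vec m (m - 1)) = e"
    by (intro eq_vecI) (auto simp: e_def unit_vec_def rconst_def one_pCons[symmetric])
  ultimately show ?thesis
    using B by (simp add: transfer_function_def resolvent_def M_def v_def)
qed

end

theory Submission
  imports Defs
begin

text \<open>Every monic polynomial of degree \<open>m\<close> is of the form \<open>P + k\<^sub>\<ell> Z\<^sub>\<ell>\<close> for a suitable \<open>\<ell>\<close>, so
  the error denominator can be assigned to be \<open>(s + 1) Z\<close>. The common factor \<open>Z\<close> then cancels, which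
  leaves the strictly positive real function \<open>1 / (s + 1)\<close>.\<close>

text \<open>The pair \<open>(1, [:a, 1:])\<close> is coprime with monic denominator, so
  \<open>quot_of_fract\<close> returns it unchanged. At the pole both sides are \<open>0\<close>,
  since division by zero gives \<open>0\<close>.\<close>

lemma rat_eval_inverse_linear:
  "rat_eval (1 / to_fract [:a, 1:]) s = 1 / (s + complex_of_real a)"
proof -
  have "(1, [:a, 1:]) \<in> normalized_fracts"
    by (simp add: normalized_fracts_def unit_factor_poly_def)
  then have "quot_of_fract (1 / to_fract [:a, 1:]) = (1, [:a, 1:])"
    using quot_of_fract_quot_to_fract'[of "(1, [:a, 1:])"]
    by (simp add: quot_to_fract_def Fract_conv_to_fract)
  then show ?thesis
    by (simp add: rat_eval_def map_poly_pCons add.commute)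
qed

text \<open>The choice \<epsilon> = \<open>a\<close> moves the pole to the origin, just outside the
  open right half-plane; the shifted function \<open>1 / s\<close> has real part
  \<open>Re s / |s|^2\<close> there.\<close>

lemma strictly_positive_real_inverse_linear:
  assumes "a > 0"
  shows "strictly_positive_real (rat_eval (1 / to_fract [:a, 1:]))"
  unfolding strictly_positive_real_def positive_real_def
proof (intro exI[of _ a] conjI allI impI)
  let ?H = "1 / to_fract [:0, 1:] :: real poly fract"
  show "a > 0" by (fact assms)
  have shift: "rat_eval (1 / to_fract [:a, 1:]) (s - complex_of_real a) = 1 / s" for s
    by (simp add: rat_eval_inverse_linear)
  show "\<exists>H. H \<noteq> 0 \<and> (\<lambda>s. rat_eval (1 / to_fract [:a, 1:]) (s - complex_of_real a)) = rat_eval H"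
    by (intro exI[of _ ?H]) (simp add: shift rat_eval_inverse_linear fun_eq_iff)
  show "(\<lambda>s. rat_eval (1 / to_fract [:a, 1:]) (s - complex_of_real a)) analytic_on {s. Re s > 0}"
    unfolding shift by (auto intro!: analytic_intros)
  show "Re (rat_eval (1 / to_fract [:a, 1:]) (s - complex_of_real a)) \<ge> 0" if "Re s > 0" for s
    using that by (simp add: shift Re_divide)
qed

lemma degree_diff_less_of_monic:
  fixes p q :: "'a::comm_ring_1 poly"
  assumes "monic p" "monic q" "degree p = degree q" "degree q > 0"
  shows "degree (p - q) < degree q"
  using assms by (intro degree_lessI) (auto simp: le_less coeff_eq_0)

theorem lemma2:
  fixes Z P :: "real poly" and m :: nat and A :: "real mat" and b c :: "real vec"
  assumes "m \<ge> 1"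
    and "monic P" and "degree P = m"
    and "monic Z" and "degree Z = m - 1"
    and "hurwitz Z"
    and "A = observer_matrix P" and "c = unit_vec m (m - 1)"
    and "b \<in> carrier_vec m" and "transfer_function A b c = to_fract Z / to_fract P"
  shows "\<exists>l \<in> carrier_vec m. \<exists>kZ :: real poly.
           transfer_function A l c = to_fract kZ / to_fract P \<and>
           strictly_positive_real (rat_eval (to_fract Z / to_fract (P + kZ)))"
proof (intro bexI exI conjI)
  define kZ where "kZ = Z * [:1, 1:] - P"
  define l where "l = vec m (coeff kZ)"
  have "Z \<noteq> 0" using \<open>monic Z\<close> by auto
  then have "degree (Z * [:1, 1:]) = m"
    using assms(1,5) by (subst degree_mult_eq) auto
  moreover have "monic (Z * [:1, 1:])"
    using \<open>monic Z\<close> by (intro monic_mult) auto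
  ultimately have "degree kZ < m"
    unfolding kZ_def using assms(1-3) degree_diff_less_of_monic[of "Z * [:1, 1:]" P] by simp
  \<comment> \<open>Because the leading terms of \<open>Z * [:1, 1:]\<close> and \<open>P\<close>
    cancel, the \<open>m\<close> entries of \<open>l\<close> capture every coefficient of
    \<open>kZ\<close>.\<close>
  then have kZ: "(\<Sum>i<m. monom (l $ i) i) = kZ"
    by (intro poly_eqI) (auto simp: l_def coeff_sum coeff_eq_0)
  show l: "l \<in> carrier_vec m" by (simp add: l_def)
  show "transfer_function A l c = to_fract kZ / to_fract P"
    using transfer_function_observer[OF assms(2,3,1) l] assms(7,8) kZ by simp
  \<comment> \<open>The product \<open>Z * [:1, 1:]\<close> must stay factored for \<open>Z\<close>
    to cancel in the fraction field, hence the deleted simp rule.\<close>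
  have "to_fract Z / to_fract (P + kZ) = 1 / to_fract [:1, 1:]"
    using \<open>Z \<noteq> 0\<close> by (simp add: kZ_def del: mult_pCons_right)
  then show "strictly_positive_real (rat_eval (to_fract Z / to_fract (P + kZ)))"
    by (simp add: strictly_positive_real_inverse_linear)
qed

end
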